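(* Let $X$ be a Hausdorff space. The following are equivalent: (1) $X$ has a point-countable base; (2) $X$ is the image of a metric space under a countably bi-quotient $s$-map; (3) $X$ is the image of a metric space under a map that is pseudo-open, boundary-compact, and an $s$-map; (4) $X$ is the image of a metric space under a map that is bi-quotient, at most boundary-one, and countable-to-one.
   Context: All spaces are Hausdorff and all maps are continuous and onto. A base is point-countable if each point belongs to at most countably many of its elements. Let $f:M\to X$ be a map. - $f$ is an $s$-map if each fiber $f^{-1}(x)$ is separable; $f$ is countable-to-one if each fiber is countable. - $f$ is boundary-compact (resp. at most boundary-one) if each boundary $\partial f^{-1}(x)$ is compact (resp. has at most one point). - $f$ is bi-quotient (resp. countably bi-quotient) if for any $x\in X$ and any (resp. any countable) family $\mathcal U$ of open subsets of $M$ with $f^{-1}(x)\subset\bigcup\mathcal U$, there is a finite $\mathcal U'\subset\mathcal U$ such that $x\in\mathrm{Int}\, f(\bigcup\mathcal U')$. - $f$ is pseudo-open if whenever $f^{-1}(x)\subset U$ with $U$ open in $M$, then $x\in\mathrm{Int}(f(U))$. *)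

theory Defs
  imports "HOL-Analysis.Analysis"
begin

definition is_base :: "'a topology \<Rightarrow> 'a set set \<Rightarrow> bool" where
  "is_base X \<B> \<longleftrightarrow>
     (\<forall>B\<in>\<B>. openin X B) \<and>
     (\<forall>U x. openin X U \<and> x \<in> U \<longrightarrow> (\<exists>B\<in>\<B>. x \<in> B \<and> B \<subseteq> U))"

definition has_point_countable_base :: "'a topology \<Rightarrow> bool" where
  "has_point_countable_base X \<longleftrightarrow>
     (\<exists>\<B>. is_base X \<B> \<and> (\<forall>x\<in>topspace X. countable {B \<in> \<B>. x \<in> B}))"

definition cont_onto :: "'m topology \<Rightarrow> 'a topology \<Rightarrow> ('m \<Rightarrow> 'a) \<Rightarrow> bool" where
  "cont_onto M X f \<longleftrightarrow> continuous_map M X f \<and> f ` topspace M = topspace X"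

text \<open>HOL functions are total, so a fibre has to be cut down to the points of the space.\<close>

definition fibre :: "'m topology \<Rightarrow> ('m \<Rightarrow> 'a) \<Rightarrow> 'a \<Rightarrow> 'm set" where
  "fibre M f x = {y \<in> topspace M. f y = x}"

text \<open>The predicates below record only the additional property; continuity and
  surjectivity are always required separately through \<^const>\<open>cont_onto\<close>.\<close>

definition s_map :: "'m topology \<Rightarrow> 'a topology \<Rightarrow> ('m \<Rightarrow> 'a) \<Rightarrow> bool" where
  "s_map M X f \<longleftrightarrow> (\<forall>x\<in>topspace X. separable_space (subtopology M (fibre M f x)))"

definition countable_to_one :: "'m topology \<Rightarrow> 'a topology \<Rightarrow> ('m \<Rightarrow> 'a) \<Rightarrow> bool" where
  "countable_to_one M X f \<longleftrightarrow> (\<forall>x\<in>topspace X. countable (fibre M f x))"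

definition boundary_compact :: "'m topology \<Rightarrow> 'a topology \<Rightarrow> ('m \<Rightarrow> 'a) \<Rightarrow> bool" where
  "boundary_compact M X f \<longleftrightarrow>
     (\<forall>x\<in>topspace X. compactin M (M frontier_of (fibre M f x)))"

definition at_most_boundary_one :: "'m topology \<Rightarrow> 'a topology \<Rightarrow> ('m \<Rightarrow> 'a) \<Rightarrow> bool" where
  "at_most_boundary_one M X f \<longleftrightarrow>
     (\<forall>x\<in>topspace X. \<exists>y. M frontier_of (fibre M f x) \<subseteq> {y})"

definition bi_quotient :: "'m topology \<Rightarrow> 'a topology \<Rightarrow> ('m \<Rightarrow> 'a) \<Rightarrow> bool" where
  "bi_quotient M X f \<longleftrightarrow>
     (\<forall>x\<in>topspace X. \<forall>\<U>. (\<forall>U\<in>\<U>. openin M U) \<and> fibre M f x \<subseteq> \<Union>\<U> \<longrightarrow>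
        (\<exists>\<U>'. finite \<U>' \<and> \<U>' \<subseteq> \<U> \<and> x \<in> X interior_of (f ` \<Union>\<U>')))"

definition countably_bi_quotient :: "'m topology \<Rightarrow> 'a topology \<Rightarrow> ('m \<Rightarrow> 'a) \<Rightarrow> bool" where
  "countably_bi_quotient M X f \<longleftrightarrow>
     (\<forall>x\<in>topspace X. \<forall>\<U>. countable \<U> \<and> (\<forall>U\<in>\<U>. openin M U) \<and> fibre M f x \<subseteq> \<Union>\<U> \<longrightarrow>
        (\<exists>\<U>'. finite \<U>' \<and> \<U>' \<subseteq> \<U> \<and> x \<in> X interior_of (f ` \<Union>\<U>')))"

definition pseudo_open :: "'m topology \<Rightarrow> 'a topology \<Rightarrow> ('m \<Rightarrow> 'a) \<Rightarrow> bool" where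
  "pseudo_open M X f \<longleftrightarrow>
     (\<forall>x\<in>topspace X. \<forall>U. openin M U \<and> fibre M f x \<subseteq> U \<longrightarrow> x \<in> X interior_of (f ` U))"

text \<open>HOL cannot quantify over types inside a formula, so ``some metric space'' needs a type
  for its points. For a space \<open>X\<close> over \<open>'a\<close> the metric spaces in the theorem have
  carriers in \<open>'m + 'a \<times> real\<close> with \<open>'m\<close> an arbitrary type variable. Since \<open>'m\<close> is universally
  quantified at theorem level, every metric space over every type is covered, up to
  the embedding \<open>Inl\<close>. The second summand makes the existence claims independent of the
  choice of \<open>'m\<close>: a separable metric space has at most continuum many points, so any metric
  space mapped onto \<open>X\<close> by an s-map (in particular by a countable-to-one map) has an
  isometric copy with carrier in \<open>'a \<times> real\<close>.\<close>

end

theory Submission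
  imports Defs
begin

text \<open>A metric space has a \<open>\<sigma>\<close>-disjoint base. Its image under a countably bi-quotient s-map is a
  point-countable cover \<open>\<P>\<close> such that every neighbourhood \<open>U\<close> of \<open>x\<close> contains \<open>\<Union>F\<close> for some finite
  \<open>F \<subseteq> \<P>\<close> with \<open>x \<in> \<Inter>F\<close> and \<open>x \<in> Int (\<Union>F)\<close>, and by the Burke--Michael form of Filippov's theorem
  such a cover yields a point-countable base. When fibre boundaries are compact and points of \<open>X\<close>
  are closed, pseudo-open maps are already bi-quotient.

  Conversely, give each point \<open>x\<close> a sequence enumerating the base sets that contain it. The space of
  these sequences, with an isolated copy of \<open>y\<close> added at every finite sequence of base sets
  containing \<open>y\<close>, is metrized by the first difference, and the obvious map onto \<open>X\<close> is bi-quotient: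
  the image of a neighbourhood of the sequence of \<open>x\<close> contains a finite intersection of base sets
  around \<open>x\<close>. Each fibre is countable and has at most one non-isolated point.\<close>

section \<open>Point-countable covers and point-countable bases\<close>

text \<open>Such an \<open>E\<close> is built from \<open>{}\<close> by adding one member at a time,
  each taken from the countable set \<open>R S\<close> of the stage \<open>S\<close> reached. Each
  stage offers only countably many sets, and \<open>E\<close> appears at stage
  \<open>card E\<close>.\<close>

lemma countable_reachable_finite_sets:
  assumes "\<And>S. countable (R S)"
  shows "countable {E. finite E \<and> (\<forall>S. S \<subset> E \<longrightarrow> (\<exists>a\<in>R S. a \<in> E - S))}"
    (is "countable ?\<A>")
proof -
  define step where "step \<S> = (\<Union>S\<in>\<S>. (\<lambda>a. insert a S) ` R S)" for \<S> :: "'a set set"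
  have cnt: "countable ((step ^^ n) {{}})" for n
    by (induction n) (auto simp: step_def assms)
  have "\<exists>S\<in>(step ^^ n) {{}}. S \<subseteq> E \<and> card S = n" if "E \<in> ?\<A>" "n \<le> card E" for E n
    using that(2)
  proof (induction n)
    case (Suc n)
    then obtain S where S: "S \<in> (step ^^ n) {{}}" "S \<subseteq> E" "card S = n"
      by auto
    with Suc.prems have "S \<subset> E" by auto
    with that(1) obtain a where a: "a \<in> R S" "a \<in> E - S" by blast
    have "finite S" using S that(1) by (auto intro: finite_subset)
    with a S have "insert a S \<in> (step ^^ Suc n) {{}}" "insert a S \<subseteq> E" "card (insert a S) = Suc n"
      by (auto simp: step_def)
    then show ?case by blast
  qed auto
  then have "E \<in> (\<Union>n. (step ^^ n) {{}})" if "E \<in> ?\<A>" for E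
    using that by (metis (mono_tags, lifting) UN_I UNIV_I card_subset_eq mem_Collect_eq order_refl)
  then have "?\<A> \<subseteq> (\<Union>n. (step ^^ n) {{}})" by blast
  then show ?thesis
    by (rule countable_subset) (use cnt in auto)
qed

text \<open>Countable tightness: only countably many finite families of members of
  \<open>\<P>\<close> through \<open>z\<close> have a neighbourhood of \<open>z\<close> as union,
  and one point of \<open>T\<close> in the interior of each such union suffices.\<close>

lemma closure_of_countable_subset:
  assumes pc: "\<And>x. x \<in> topspace X \<Longrightarrow> countable {A \<in> \<P>. x \<in> A}"
    and nb: "\<And>U x. openin X U \<Longrightarrow> x \<in> U \<Longrightarrow>
      \<exists>F. finite F \<and> F \<subseteq> \<P> \<and> (\<forall>A\<in>F. x \<in> A) \<and> x \<in> X interior_of \<Union>F \<and> \<Union>F \<subseteq> U"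
    and z: "z \<in> X closure_of T"
  shows "\<exists>C. countable C \<and> C \<subseteq> T \<and> z \<in> X closure_of C"
proof -
  have zX: "z \<in> topspace X" using z by (simp add: in_closure_of)
  define \<N> where "\<N> = {G. finite G \<and> G \<subseteq> {A \<in> \<P>. z \<in> A} \<and> z \<in> X interior_of \<Union>G}"
  have "countable \<N>"
    by (rule countable_subset[OF _ countable_Collect_finite_subset[OF pc[OF zX]]])
      (auto simp: \<N>_def)
  moreover have "\<forall>G\<in>\<N>. \<exists>c. c \<in> T \<and> c \<in> X interior_of \<Union>G"
    using z by (auto simp: \<N>_def in_closure_of)
  then obtain c where c: "\<And>G. G \<in> \<N> \<Longrightarrow> c G \<in> T \<and> c G \<in> X interior_of \<Union>G"
    by metis
  moreover have "\<exists>y\<in>c ` \<N>. y \<in> U" if U: "openin X U" "z \<in> U" for U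
  proof -
    obtain F where F: "finite F" "F \<subseteq> \<P>" "\<forall>A\<in>F. z \<in> A" "z \<in> X interior_of \<Union>F" "\<Union>F \<subseteq> U"
      using nb[OF U] by blast
    then have "F \<in> \<N>" by (auto simp: \<N>_def)
    with c[of F] F(5) interior_of_subset[of X "\<Union>F"] show ?thesis by blast
  qed
  ultimately show ?thesis
    using zX by (intro exI[of _ "c ` \<N>"]) (auto simp: in_closure_of)
qed

text \<open>If \<open>y \<in> V E\<close> below, then \<open>E\<close> is reachable from \<open>y\<close> in countably many ways: \<open>y\<close> lies in some \<open>Q \<in> \<P>\<close>
  that also contains a point \<open>x\<close> at which \<open>E\<close> is minimal, and \<open>Q\<close> is contained in the interior of \<open>\<Union>E\<close>.
  For \<open>S \<subset> E\<close> minimality puts \<open>x\<close> in the closure of the complement of \<open>\<Union>S\<close>. The set \<open>C Q S\<close>, which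
  depends on \<open>Q\<close> and \<open>S\<close> only, clusters at a (perhaps different) point of \<open>Q\<close> and therefore meets \<open>\<Union>E\<close>
  outside \<open>\<Union>S\<close>, so a new member of \<open>E\<close> is found among the countably many sets that meet \<open>C Q S\<close>.\<close>

theorem point_countable_base_of_cover:
  assumes pc: "\<And>x. x \<in> topspace X \<Longrightarrow> countable {A \<in> \<P>. x \<in> A}"
    and nb: "\<And>U x. openin X U \<Longrightarrow> x \<in> U \<Longrightarrow>
      \<exists>F. finite F \<and> F \<subseteq> \<P> \<and> (\<forall>A\<in>F. x \<in> A) \<and> x \<in> X interior_of \<Union>F \<and> \<Union>F \<subseteq> U"
  shows "has_point_countable_base X"
proof -
  define good where "good Q S C \<longleftrightarrow> countable C \<and> C \<subseteq> topspace X - \<Union>S \<and>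
      (Q \<inter> X closure_of (topspace X - \<Union>S) \<noteq> {} \<longrightarrow> Q \<inter> X closure_of C \<noteq> {})" for Q S C
  have "\<exists>C. good Q S C" for Q S
  proof (cases "Q \<inter> X closure_of (topspace X - \<Union>S) = {}")
    case True
    then show ?thesis by (intro exI[of _ "{}"]) (simp add: good_def)
  next
    case False
    then obtain z where z: "z \<in> Q" "z \<in> X closure_of (topspace X - \<Union>S)" by blast
    obtain C where "countable C" "C \<subseteq> topspace X - \<Union>S" "z \<in> X closure_of C"
      using closure_of_countable_subset[of X \<P>, OF pc nb z(2)] by metis
    with z(1) show ?thesis by (intro exI[of _ C]) (auto simp: good_def)
  qed
  then obtain C where "\<And>Q S. good Q S (C Q S)" by metis
  then have C: "\<And>Q S. countable (C Q S)" "\<And>Q S. C Q S \<subseteq> topspace X - \<Union>S"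
    "\<And>Q S. Q \<inter> X closure_of (topspace X - \<Union>S) \<noteq> {} \<Longrightarrow> Q \<inter> X closure_of (C Q S) \<noteq> {}"
    unfolding good_def by simp_all
  define R where "R Q S = (\<Union>c\<in>C Q S. {A \<in> \<P>. c \<in> A})" for Q S
  have R: "countable (R Q S)" for Q S
    unfolding R_def
  proof (rule countable_UN[OF C(1)])
    fix c assume "c \<in> C Q S"
    with C(2) have "c \<in> topspace X" by blast
    then show "countable {A \<in> \<P>. c \<in> A}" by (rule pc)
  qed
  define minimal_at where "minimal_at x E \<longleftrightarrow> finite E \<and> E \<subseteq> \<P> \<and> x \<in> X interior_of \<Union>E \<and>
     (\<forall>S. S \<subset> E \<longrightarrow> x \<notin> X interior_of \<Union>S)" for x E
  define \<G> where "\<G> E = {G. \<exists>x. minimal_at x E \<and> (\<forall>A\<in>G. x \<in> A) \<and> G \<subseteq> \<P> \<and>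
     x \<in> X interior_of \<Union>G \<and> \<Union>G \<subseteq> X interior_of \<Union>E}" for E
  \<comment> \<open>\<open>V E\<close> is determined by \<open>E\<close> alone, so counting the base
    sets through a point reduces to counting families \<open>E\<close>.\<close>
  define V where "V E = (\<Union>G\<in>\<G> E. X interior_of \<Union>G)" for E
  have VE: "V E \<subseteq> \<Union>E" for E
  proof
    fix y assume "y \<in> V E"
    then obtain G where "\<Union>G \<subseteq> X interior_of \<Union>E" "y \<in> X interior_of \<Union>G"
      by (auto simp: V_def \<G>_def)
    then show "y \<in> \<Union>E"
      using interior_of_subset[of X "\<Union>G"] interior_of_subset[of X "\<Union>E"] by (meson subsetD)
  qed
  have reach: "\<exists>Q\<in>\<P>. y \<in> Q \<and> finite E \<and> (\<forall>S. S \<subset> E \<longrightarrow> (\<exists>A\<in>R Q S. A \<in> E - S))"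
    if y: "y \<in> V E" for y E
  proof -
    obtain G x where G: "minimal_at x E" "\<forall>A\<in>G. x \<in> A" "G \<subseteq> \<P>"
      "\<Union>G \<subseteq> X interior_of \<Union>E" "y \<in> X interior_of \<Union>G"
      using y unfolding V_def \<G>_def by blast
    then obtain Q where Q: "Q \<in> G" "y \<in> Q"
      using interior_of_subset[of X "\<Union>G"] by blast
    have "\<exists>A\<in>R Q S. A \<in> E - S" if "S \<subset> E" for S
    proof -
      have "x \<in> topspace X" "x \<notin> X interior_of \<Union>S"
        using G(1) that interior_of_subset_topspace[of X "\<Union>E"] unfolding minimal_at_def by blast+
      then have "x \<in> X closure_of (topspace X - \<Union>S)"
        unfolding interior_of_closure_of[of X "\<Union>S"] by blast
      then have "Q \<inter> X closure_of (topspace X - \<Union>S) \<noteq> {}"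
        using G(2) Q(1) by blast
      then obtain z where "z \<in> Q" "z \<in> X closure_of (C Q S)"
        using C(3) by blast
      moreover have "z \<in> X interior_of \<Union>E" using G(4) Q(1) \<open>z \<in> Q\<close> by blast
      ultimately obtain c where c: "c \<in> C Q S" "c \<in> X interior_of \<Union>E"
        by (auto simp: in_closure_of)
      then obtain A where "A \<in> E" "c \<in> A"
        using interior_of_subset[of X "\<Union>E"] by blast
      moreover have "A \<notin> S" using C(2)[of Q S] c(1) \<open>c \<in> A\<close> by blast
      moreover have "A \<in> R Q S"
        using G(1) c(1) calculation by (auto simp: R_def minimal_at_def)
      ultimately show ?thesis by blast
    qed
    with G(1,3) Q show ?thesis by (auto simp: minimal_at_def)
  qed
  have "is_base X (range V)"
    unfolding is_base_def
  proof (intro conjI ballI allI impI)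
    fix B assume "B \<in> range V"
    then show "openin X B" by (auto simp: V_def)
  next
    fix U x assume "openin X U \<and> x \<in> U"
    then obtain F where F: "finite F" "F \<subseteq> \<P>" "x \<in> X interior_of \<Union>F" "\<Union>F \<subseteq> U"
      using nb[of U x] by blast
    \<comment> \<open>Shrinking \<open>F\<close> to a minimal subfamily gives the minimality in
      \<open>minimal_at\<close>; a second use of \<open>nb\<close>, on the interior of
      \<open>\<Union>E\<close>, then supplies \<open>G\<close>.\<close>
    obtain E where E: "E \<subseteq> F" "x \<in> X interior_of \<Union>E"
        "\<And>S. S \<subset> E \<Longrightarrow> x \<notin> X interior_of \<Union>S"
    proof -
      let ?K = "{E. E \<subseteq> F \<and> x \<in> X interior_of \<Union>E}"
      have "finite ?K" "F \<in> ?K" using F by auto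
      from finite_has_minimal2[OF this] obtain E where E: "E \<in> ?K" "\<forall>S\<in>?K. S \<subseteq> E \<longrightarrow> E = S"
        by blast
      show thesis
      proof (rule that)
        show "E \<subseteq> F" "x \<in> X interior_of \<Union>E" using E(1) by simp_all
        show "x \<notin> X interior_of \<Union>S" if "S \<subset> E" for S
        proof
          assume "x \<in> X interior_of \<Union>S"
          with that E(1) have "S \<in> ?K" by blast
          with E(2) that show False by blast
        qed
      qed
    qed
    have "finite E" using E(1) F(1) by (rule finite_subset)
    with E F(2) have min: "minimal_at x E"
      unfolding minimal_at_def by blast
    obtain G where "finite G" "G \<subseteq> \<P>" "\<forall>A\<in>G. x \<in> A" "x \<in> X interior_of \<Union>G"
      "\<Union>G \<subseteq> X interior_of \<Union>E"
      using nb[OF openin_interior_of E(2)] by metis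
    with min have "G \<in> \<G> E" unfolding \<G>_def by blast
    with \<open>x \<in> X interior_of \<Union>G\<close> have "x \<in> V E" unfolding V_def by blast
    moreover have "V E \<subseteq> U" using VE E(1) F(4) by blast
    ultimately show "\<exists>B\<in>range V. x \<in> B \<and> B \<subseteq> U" by blast
  qed
  moreover have "countable {B \<in> range V. y \<in> B}" if "y \<in> topspace X" for y
  proof -
    define \<E> where "\<E> Q = {E. finite E \<and> (\<forall>S. S \<subset> E \<longrightarrow> (\<exists>A\<in>R Q S. A \<in> E - S))}" for Q
    have "{B \<in> range V. y \<in> B} \<subseteq> V ` (\<Union>Q\<in>{A \<in> \<P>. y \<in> A}. \<E> Q)"
    proof clarify
      fix E assume "y \<in> V E"
      from reach[OF this] have "E \<in> (\<Union>Q\<in>{A \<in> \<P>. y \<in> A}. \<E> Q)"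
        unfolding \<E>_def by blast
      then show "V E \<in> V ` (\<Union>Q\<in>{A \<in> \<P>. y \<in> A}. \<E> Q)" by (rule imageI)
    qed
    moreover have "countable (\<Union>Q\<in>{A \<in> \<P>. y \<in> A}. \<E> Q)"
      unfolding \<E>_def by (rule countable_UN[OF pc[OF that] countable_reachable_finite_sets[OF R]])
    ultimately show ?thesis by (meson countable_image countable_subset)
  qed
  ultimately show ?thesis unfolding has_point_countable_base_def by blast
qed

section \<open>Images of metric spaces\<close>

text \<open>\<open>a k x\<close> is the first centre, in a well-order of the points, whose ball of radius \<open>1/(k+1)\<close>
  contains \<open>x\<close>. For fixed \<open>k\<close> and \<open>n\<close> the sets \<open>D k n c\<close> are disjoint, as in M. E. Rudin's proof of
  Stone's theorem.\<close>

lemma (in Metric_space) point_countable_base: "has_point_countable_base mtopology"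
proof -
  obtain r :: "'a rel" where r: "well_order_on UNIV r"
    using well_order_on by blast
  define a where "a k x = (SOME a. a \<in> M \<and> d a x < inverse (Suc k) \<and>
      (\<forall>b\<in>M. d b x < inverse (Suc k) \<longrightarrow> (a, b) \<in> r))" for k x
  have a: "a k x \<in> M \<and> d (a k x) x < inverse (Suc k) \<and>
      (\<forall>b\<in>M. d b x < inverse (Suc k) \<longrightarrow> (a k x, b) \<in> r)" if "x \<in> M" for k x
  proof -
    let ?S = "{b \<in> M. d b x < inverse (Suc k)}"
    interpret wo_rel r using well_order_on_Well_order[OF r] unfolding wo_rel_def by blast
    have "Field r = UNIV" using well_order_on_Well_order[OF r] by simp
    moreover have "?S \<noteq> {}" using that by auto
    ultimately have "minim ?S \<in> ?S" "\<And>b. b \<in> ?S \<Longrightarrow> (minim ?S, b) \<in> r"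
      by (metis minim_in subset_UNIV, metis minim_least subset_UNIV)
    then have "\<exists>a. a \<in> M \<and> d a x < inverse (Suc k) \<and>
        (\<forall>b\<in>M. d b x < inverse (Suc k) \<longrightarrow> (a, b) \<in> r)" by blast
    then show ?thesis
      unfolding a_def by (rule someI_ex)
  qed
  define D where "D k n c = (\<Union>x\<in>{x \<in> M. a k x = c \<and>
      mball x (2 * inverse (Suc n)) \<subseteq> mball c (inverse (Suc k))}. mball x (inverse (Suc n)))"
    for k n :: nat and c
  have unique: "c = c'" if "y \<in> D k n c" "y \<in> D k n c'" for y k n c c'
  proof -
    obtain x x' where x: "x \<in> M" "a k x = c" "y \<in> mball x (inverse (Suc n))"
        "mball x (2 * inverse (Suc n)) \<subseteq> mball c (inverse (Suc k))"
      and x': "x' \<in> M" "a k x' = c'" "y \<in> mball x' (inverse (Suc n))"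
        "mball x' (2 * inverse (Suc n)) \<subseteq> mball c' (inverse (Suc k))"
      using \<open>y \<in> D k n c\<close> \<open>y \<in> D k n c'\<close> unfolding D_def by blast
    \<comment> \<open>The doubled radius in \<open>D\<close> is spent here: each of
      \<open>x\<close>, \<open>x'\<close> falls into the ball about the other's first centre, so
      \<open>c\<close> and \<open>c'\<close> precede each other in \<open>r\<close>.\<close>
    have "d x x' < 2 * inverse (Suc n)"
      using triangle[of x y x'] x(1,3) x'(1,3) by (auto simp: commute)
    then have "x' \<in> mball c (inverse (Suc k))" "x \<in> mball c' (inverse (Suc k))"
      using x x' by (auto simp: commute subset_iff)
    then have "(c, c') \<in> r" "(c', c) \<in> r"
      using a[OF x(1), of k] a[OF x'(1), of k] x(2) x'(2) by auto
    then show ?thesis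
      using r by (auto simp: well_order_on_def linear_order_on_def partial_order_on_def antisym_def)
  qed
  define \<D> where "\<D> = (\<Union>k n. range (D k n))"
  have "is_base mtopology \<D>"
    unfolding is_base_def
  proof (intro conjI ballI allI impI)
    fix B assume "B \<in> \<D>"
    then show "openin mtopology B" by (auto simp: \<D>_def D_def)
  next
    fix U x assume U: "openin mtopology U \<and> x \<in> U"
    then obtain \<delta> where \<delta>: "\<delta> > 0" "mball x \<delta> \<subseteq> U" and x: "x \<in> M"
      by (meson openin_mtopology subsetD)
    \<comment> \<open>The ball of radius \<open>1/(k+1)\<close> about \<open>a k x\<close> contains
      \<open>x\<close>, possibly off centre, so halving \<open>\<delta>\<close> keeps it inside
      \<open>mball x \<delta>\<close>. The slack left at \<open>x\<close> then determines
      \<open>n\<close>.\<close>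
    obtain k where k: "inverse (real (Suc k)) < \<delta> / 2"
      using reals_Archimedean[of "\<delta> / 2"] \<delta>(1) by auto
    have ak: "a k x \<in> M" "d (a k x) x < inverse (Suc k)" using a[OF x] by auto
    obtain n where n: "inverse (real (Suc n)) < (inverse (Suc k) - d (a k x) x) / 2"
      using reals_Archimedean[of "(inverse (Suc k) - d (a k x) x) / 2"] ak by auto
    have "mball x (2 * inverse (Suc n)) \<subseteq> mball (a k x) (inverse (Suc k))"
      using n ak by (intro mball_subset) (auto simp: commute)
    then have "x \<in> D k n (a k x)"
      using x unfolding D_def by auto
    moreover have "D k n (a k x) \<subseteq> mball (a k x) (inverse (Suc k))"
    proof -
      have "mball z (inverse (Suc n)) \<subseteq> mball z (2 * inverse (Suc n))" for z
        by (intro mball_subset_concentric) simp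
      then show ?thesis unfolding D_def by blast
    qed
    moreover have "mball (a k x) (inverse (Suc k)) \<subseteq> mball x \<delta>"
      using k ak x by (intro mball_subset) auto
    ultimately show "\<exists>B\<in>\<D>. x \<in> B \<and> B \<subseteq> U"
      using \<delta>(2) unfolding \<D>_def by blast
  qed
  moreover have "countable {B \<in> \<D>. y \<in> B}" for y
  proof (rule countable_subset)
    \<comment> \<open>By \<open>unique\<close> each pair \<open>(k, n)\<close> contributes at most
      one set through \<open>y\<close>; the arbitrary value of \<open>THE\<close> at other pairs
      only enlarges a countable image.\<close>
    show "{B \<in> \<D>. y \<in> B} \<subseteq> (\<lambda>(k, n). D k n (THE c. y \<in> D k n c)) ` UNIV"
    proof
      fix B assume "B \<in> {B \<in> \<D>. y \<in> B}"
      then obtain k n c where "B = D k n c" "y \<in> D k n c" by (auto simp: \<D>_def)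
      moreover from this have "(THE c. y \<in> D k n c) = c" using unique by blast
      ultimately show "B \<in> (\<lambda>(k, n). D k n (THE c. y \<in> D k n c)) ` UNIV"
        by (intro image_eqI[of _ _ "(k, n)"]) auto
    qed
  qed auto
  ultimately show ?thesis by (auto simp: has_point_countable_base_def)
qed

lemma mtopology_of_point_countable_base: "has_point_countable_base (mtopology_of m)"
  by (simp add: mtopology_of_def Metric_space.point_countable_base)

text \<open>A base set meeting \<open>S\<close> already contains a point of a countable dense subset
  of \<open>S\<close>, and each such point lies in countably many base sets.\<close>

lemma countable_base_meets_separable:
  assumes "is_base M \<B>" "\<And>x. x \<in> topspace M \<Longrightarrow> countable {B \<in> \<B>. x \<in> B}"
    and S: "S \<subseteq> topspace M" "separable_space (subtopology M S)"
  shows "countable {B \<in> \<B>. B \<inter> S \<noteq> {}}"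
proof -
  obtain D where D: "countable D" "D \<subseteq> S" "subtopology M S closure_of D = S"
    using S by (auto simp: separable_space_def Int_absorb1)
  have "{B \<in> \<B>. B \<inter> S \<noteq> {}} \<subseteq> (\<Union>x\<in>D. {B \<in> \<B>. x \<in> B})"
  proof
    fix B assume "B \<in> {B \<in> \<B>. B \<inter> S \<noteq> {}}"
    then obtain z where B: "B \<in> \<B>" "z \<in> B" "z \<in> S" by blast
    then have "z \<in> subtopology M S closure_of D" "openin (subtopology M S) (B \<inter> S)"
      using D(3) assms(1) by (auto simp: is_base_def openin_subtopology)
    then have "\<exists>x\<in>D. x \<in> B \<inter> S"
      using B by (auto simp: in_closure_of)
    then show "B \<in> (\<Union>x\<in>D. {B \<in> \<B>. x \<in> B})" using B by blast
  qed
  then show ?thesis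
    by (rule countable_subset) (use D S assms(2) in blast)
qed

text \<open>The images of base sets serve as the cover in
  \<open>point_countable_base_of_cover\<close>. Such an image contains \<open>x\<close> iff the base
  set meets the fibre, so separable fibres make the cover point-countable and also make the family
  fed to countable bi-quotience countable.\<close>

theorem countably_bi_quotient_s_image_point_countable_base:
  assumes "has_point_countable_base M" "cont_onto M X f" "countably_bi_quotient M X f" "s_map M X f"
  shows "has_point_countable_base X"
proof -
  obtain \<B> where \<B>: "is_base M \<B>" "\<And>x. x \<in> topspace M \<Longrightarrow> countable {B \<in> \<B>. x \<in> B}"
    using assms(1) by (auto simp: has_point_countable_base_def)
  have meets: "countable {B \<in> \<B>. B \<inter> fibre M f x \<noteq> {}}" if "x \<in> topspace X" for x
    using assms(4) that by (intro countable_base_meets_separable[OF \<B>]) (auto simp: s_map_def fibre_def)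
  have opn: "openin M B" if "B \<in> \<B>" for B using \<B>(1) that by (simp add: is_base_def)
  show ?thesis
  proof (rule point_countable_base_of_cover)
    fix x assume x: "x \<in> topspace X"
    have "{A \<in> (`) f ` \<B>. x \<in> A} \<subseteq> (`) f ` {B \<in> \<B>. B \<inter> fibre M f x \<noteq> {}}"
      using openin_subset[OF opn] unfolding fibre_def by blast
    then show "countable {A \<in> (`) f ` \<B>. x \<in> A}"
      using meets[OF x] by (blast intro: countable_subset)
  next
    fix U x assume U: "openin X U" "x \<in> U"
    then have x: "x \<in> topspace X" using openin_subset by blast
    define W where "W = {y \<in> topspace M. f y \<in> U}"
    have "openin M W"
      using assms(2) U unfolding W_def cont_onto_def by (auto intro: openin_continuous_map_preimage)
    define \<U> where "\<U> = {B \<in> \<B>. B \<inter> fibre M f x \<noteq> {} \<and> B \<subseteq> W}"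
    have "fibre M f x \<subseteq> \<Union>\<U>"
    proof
      fix y assume y: "y \<in> fibre M f x"
      then have "y \<in> W" using U by (auto simp: W_def fibre_def)
      then obtain B where "B \<in> \<B>" "y \<in> B" "B \<subseteq> W"
        using \<B>(1) \<open>openin M W\<close> unfolding is_base_def by blast
      then show "y \<in> \<Union>\<U>" using y by (auto simp: \<U>_def)
    qed
    moreover have "countable \<U>"
      by (rule countable_subset[OF _ meets[OF x]]) (auto simp: \<U>_def)
    moreover have "\<forall>B\<in>\<U>. openin M B" using opn by (auto simp: \<U>_def)
    ultimately obtain \<U>' where \<U>': "finite \<U>'" "\<U>' \<subseteq> \<U>" "x \<in> X interior_of (f ` \<Union>\<U>')"
      using assms(3)[unfolded countably_bi_quotient_def, rule_format, OF x, of \<U>] by metis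
    have "f ` \<Union>\<U>' = \<Union>((`) f ` \<U>')" by blast
    then show "\<exists>F. finite F \<and> F \<subseteq> (`) f ` \<B> \<and> (\<forall>A\<in>F. x \<in> A) \<and> x \<in> X interior_of \<Union>F \<and> \<Union>F \<subseteq> U"
    proof (intro exI[of _ "(`) f ` \<U>'"] conjI ballI)
      show "finite ((`) f ` \<U>')" using \<U>'(1) by simp
      show "(`) f ` \<U>' \<subseteq> (`) f ` \<B>" using \<U>'(2) by (auto simp: \<U>_def)
      show "\<Union>((`) f ` \<U>') \<subseteq> U" using \<U>'(2) by (auto simp: \<U>_def W_def)
      show "x \<in> X interior_of \<Union>((`) f ` \<U>')" using \<U>'(3) \<open>f ` \<Union>\<U>' = \<Union>((`) f ` \<U>')\<close> by simp
      show "x \<in> A" if "A \<in> (`) f ` \<U>'" for A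
        using that \<U>'(2) by (auto simp: \<U>_def fibre_def)
    qed
  qed
qed

section \<open>Implications between the classes of maps\<close>

lemma bi_quotient_imp_countably_bi_quotient:
  "bi_quotient M X f \<Longrightarrow> countably_bi_quotient M X f"
  by (simp add: bi_quotient_def countably_bi_quotient_def)

lemma bi_quotient_imp_pseudo_open:
  assumes "bi_quotient M X f"
  shows "pseudo_open M X f"
  unfolding pseudo_open_def
proof (intro ballI allI impI)
  fix x U assume x: "x \<in> topspace X" and U: "openin M U \<and> fibre M f x \<subseteq> U"
  then obtain \<U>' where "\<U>' \<subseteq> {U}" "x \<in> X interior_of (f ` \<Union>\<U>')"
    using assms[unfolded bi_quotient_def, rule_format, of x "{U}"] by auto
  moreover have "f ` \<Union>\<U>' \<subseteq> f ` U" using calculation(1) by blast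
  ultimately show "x \<in> X interior_of (f ` U)"
    using interior_of_mono[of "f ` \<Union>\<U>'" "f ` U" X] by blast
qed

lemma at_most_boundary_one_imp_boundary_compact:
  "at_most_boundary_one M X f \<Longrightarrow> boundary_compact M X f"
  unfolding at_most_boundary_one_def boundary_compact_def
  by (meson finite.emptyI finite_imp_compactin finite_insert finite_subset frontier_of_subset_topspace)

lemma countable_to_one_imp_s_map:
  "countable_to_one M X f \<Longrightarrow> s_map M X f"
  unfolding countable_to_one_def s_map_def separable_space_def
  by (metis closure_of_topspace countable_Int2 inf_commute order_refl topspace_subtopology)

text \<open>Once finitely many sets cover the boundary of the fibre, the rest of the fibre is contained in
  an open set with image \<open>{x}\<close>.\<close>

lemma pseudo_open_boundary_compact_imp_bi_quotient:
  assumes "t1_space X" "cont_onto M X f" "pseudo_open M X f" "boundary_compact M X f"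
  shows "bi_quotient M X f"
  unfolding bi_quotient_def
proof (intro ballI allI impI)
  fix x \<U> assume x: "x \<in> topspace X"
    and \<U>: "(\<forall>U\<in>\<U>. openin M U) \<and> fibre M f x \<subseteq> \<Union>\<U>"
  let ?F = "fibre M f x"
  have "closedin M {y \<in> topspace M. f y \<in> {x}}"
    using assms(1,2) x by (intro closedin_continuous_map_preimage) (auto simp: cont_onto_def closedin_t1_singleton)
  then have clo: "closedin M ?F" by (simp add: fibre_def)
  have fr: "M frontier_of ?F = ?F - M interior_of ?F"
    using clo by (simp add: frontier_of_def closure_of_closedin)
  have "compactin M (M frontier_of ?F)" using assms(4) x by (simp add: boundary_compact_def)
  then obtain \<V> where \<V>: "finite \<V>" "\<V> \<subseteq> \<U>" "M frontier_of ?F \<subseteq> \<Union>\<V>"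
    using \<U> fr unfolding compactin_def by (metis Diff_subset order_trans)
  \<comment> \<open>The boundary may be empty, and \<open>\<V>\<close> with it. A member
    \<open>U\<close> through some point of the fibre ensures that the image contains
    \<open>x\<close>, the only value \<open>f\<close> takes on the interior of the fibre.\<close>
  have "x \<in> f ` topspace M" using assms(2) x by (simp add: cont_onto_def)
  then obtain y where y: "y \<in> ?F" by (auto simp: fibre_def)
  then obtain U where U: "U \<in> \<U>" "y \<in> U" using \<U> by blast
  let ?\<U>' = "insert U \<V>"
  have "openin M (\<Union>?\<U>' \<union> M interior_of ?F)"
    using \<U> U(1) \<V>(2) by (intro openin_Un openin_Union openin_interior_of) auto
  moreover have "?F \<subseteq> \<Union>?\<U>' \<union> M interior_of ?F" using \<V>(3) fr by auto
  ultimately have "x \<in> X interior_of (f ` (\<Union>?\<U>' \<union> M interior_of ?F))"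
    using assms(3) x by (simp add: pseudo_open_def)
  moreover have "f ` (\<Union>?\<U>' \<union> M interior_of ?F) \<subseteq> f ` \<Union>?\<U>'"
  proof
    fix z assume "z \<in> f ` (\<Union>?\<U>' \<union> M interior_of ?F)"
    then obtain p where p: "p \<in> \<Union>?\<U>' \<union> M interior_of ?F" "z = f p" by blast
    have "f y = x" "f p = x" if "p \<in> M interior_of ?F"
      using y interior_of_subset[of M ?F] that unfolding fibre_def by blast+
    with p U(2) show "z \<in> f ` \<Union>?\<U>'" by fastforce
  qed
  ultimately have "x \<in> X interior_of (f ` \<Union>?\<U>')" by (meson interior_of_mono subsetD)
  then show "\<exists>\<U>'. finite \<U>' \<and> \<U>' \<subseteq> \<U> \<and> x \<in> X interior_of (f ` \<Union>\<U>')"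
    using \<V> U by (intro exI[of _ ?\<U>']) auto
qed

section \<open>Construction of the metric space\<close>

text \<open>The first-difference ultrametric on sequences, pulled back along \<open>\<sigma>\<close>
  so that points may have any type. Equal points are split off because \<open>LEAST\<close> has no
  witness there.\<close>

definition seq_dist :: "('p \<Rightarrow> nat \<Rightarrow> 'c) \<Rightarrow> 'p \<Rightarrow> 'p \<Rightarrow> real" where
  "seq_dist \<sigma> u v = (if u = v then 0 else (1/2) ^ (LEAST n. \<sigma> u n \<noteq> \<sigma> v n))"

text \<open>Strictness yields agreement at index \<open>n\<close> itself, so a ball of radius
  \<open>(1/2) ^ n\<close> determines coordinate \<open>n\<close>.\<close>

lemma seq_dist_less_imp_eq:
  assumes "seq_dist \<sigma> u v < (1/2) ^ n" "i \<le> n"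
  shows "\<sigma> u i = \<sigma> v i"
proof (cases "u = v")
  case False
  then have "n < (LEAST n. \<sigma> u n \<noteq> \<sigma> v n)"
    using assms(1) by (simp add: seq_dist_def power_strict_decreasing_iff)
  with assms(2) have "i < (LEAST n. \<sigma> u n \<noteq> \<sigma> v n)" by simp
  then show ?thesis using not_less_Least by blast
qed auto

lemma seq_dist_le:
  assumes "inj_on \<sigma> S" "u \<in> S" "v \<in> S" "\<And>i. i < n \<Longrightarrow> \<sigma> u i = \<sigma> v i"
  shows "seq_dist \<sigma> u v \<le> (1/2) ^ n"
proof (cases "u = v")
  case False
  then have "\<sigma> u \<noteq> \<sigma> v" using assms(1-3) by (auto dest: inj_onD)
  then have "\<exists>i. \<sigma> u i \<noteq> \<sigma> v i" by blast
  from LeastI_ex[OF this] have "n \<le> (LEAST n. \<sigma> u n \<noteq> \<sigma> v n)"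
    using assms(4) by (meson not_le_imp_less)
  then show ?thesis using False by (simp add: seq_dist_def power_decreasing)
qed (auto simp: seq_dist_def)

lemma Metric_space_seq_dist:
  assumes "inj_on \<sigma> S"
  shows "Metric_space S (seq_dist \<sigma>)"
proof
  fix u v w
  show "0 \<le> seq_dist \<sigma> u v" for u v by (simp add: seq_dist_def)
  show "seq_dist \<sigma> u v = seq_dist \<sigma> v u" by (simp add: seq_dist_def eq_commute)
  show "seq_dist \<sigma> u v = 0 \<longleftrightarrow> u = v" by (simp add: seq_dist_def)
  assume S: "u \<in> S" "v \<in> S" "w \<in> S"
  show "seq_dist \<sigma> u w \<le> seq_dist \<sigma> u v + seq_dist \<sigma> v w"
  proof (cases "u = v \<or> v = w")
    case False
    let ?m = "LEAST n. \<sigma> u n \<noteq> \<sigma> v n" and ?n = "LEAST n. \<sigma> v n \<noteq> \<sigma> w n"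
    have "\<sigma> u i = \<sigma> w i" if "i < min ?m ?n" for i
      using that by (metis (mono_tags, lifting) min_less_iff_conj not_less_Least)
    then have "seq_dist \<sigma> u w \<le> (1/2) ^ min ?m ?n"
      by (rule seq_dist_le[OF assms S(1,3)])
    also have "\<dots> \<le> seq_dist \<sigma> u v + seq_dist \<sigma> v w"
      using False by (simp add: seq_dist_def min_def)
    finally show ?thesis .
  qed (auto simp: seq_dist_def)
qed

text \<open>\<open>e x\<close> enumerates the members of the base that contain \<open>x\<close>. The point \<open>(x, 0)\<close> will be the
  only boundary point of its fibre; the points \<open>(x, Suc k)\<close> will be isolated because the tag
  \<open>Inr (x, k)\<close> occurs in no other sequence.\<close>

definition point_code :: "('a \<Rightarrow> nat \<Rightarrow> 'a set) \<Rightarrow> 'a \<times> nat \<Rightarrow> nat \<Rightarrow> 'a set + 'a \<times> nat" where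
  "point_code e p n = (case p of (x, 0) \<Rightarrow> Inl (e x n)
     | (x, Suc k) \<Rightarrow> let l = from_nat k :: nat list in if n < length l then Inl (e x (l ! n)) else Inr (x, k))"

lemma point_code_simps:
  "point_code e (x, 0) n = Inl (e x n)"
  "point_code e (x, Suc k) n = (if n < length (from_nat k :: nat list)
     then Inl (e x ((from_nat k :: nat list) ! n)) else Inr (x, k))"
  by (simp_all add: point_code_def Let_def)

lemma point_code_Inl: "point_code e (x, k) n = Inl B \<Longrightarrow> B \<in> range (e x)"
  by (cases k) (auto simp: point_code_simps split: if_splits)

lemma point_code_Inr: "point_code e p n = Inr (x, k) \<Longrightarrow> p = (x, Suc k)"
  by (cases p; cases "snd p") (auto simp: point_code_simps split: if_splits)

lemma point_code_tag: "point_code e (x, Suc k) (length (from_nat k :: nat list)) = Inr (x, k)"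
  by (simp add: point_code_simps)

text \<open>Untagged codes list \<open>range (e x)\<close>, which determines \<open>x\<close>; a tag
  in one code also occurs in the other and names the point.\<close>

lemma inj_on_point_code:
  assumes "inj_on (\<lambda>x. range (e x)) S"
  shows "inj_on (point_code e) (S \<times> UNIV)"
proof (rule inj_onI, clarify)
  fix x k y k' assume *: "x \<in> S" "y \<in> S" "point_code e (x, k) = point_code e (y, k')"
  show "x = y \<and> k = k'"
  proof (cases "k = 0 \<and> k' = 0")
    case True
    then have "e x n = e y n" for n using fun_cong[OF *(3), of n] by (simp add: point_code_simps)
    then have "range (e x) = range (e y)" by simp
    then show ?thesis using assms *(1,2) True by (auto dest: inj_onD)
  next
    case False
    then consider i where "k = Suc i" | i where "k' = Suc i" by (metis not0_implies_Suc)
    then show ?thesis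
    proof cases
      case 1
      then have "point_code e (y, k') (length (from_nat i :: nat list)) = Inr (x, i)"
        using point_code_tag[of e x i] *(3) by simp
      from point_code_Inr[OF this] 1 show ?thesis by simp
    next
      case 2
      then have "point_code e (x, k) (length (from_nat i :: nat list)) = Inr (y, i)"
        using point_code_tag[of e y i] *(3) by simp
      from point_code_Inr[OF this] 2 show ?thesis by simp
    qed
  qed
qed

text \<open>The injection \<open>j\<close> moves the points \<open>(x, k)\<close> into a prescribed
  type \<open>'p\<close>, as the final statement fixes the type of its metric spaces.\<close>

theorem point_countable_base_imp_bi_quotient_image:
  fixes X :: "'a topology" and j :: "'a \<times> nat \<Rightarrow> 'p"
  assumes X: "Hausdorff_space X" "has_point_countable_base X" and j: "inj j"
  shows "\<exists>(m :: 'p metric) f. cont_onto (mtopology_of m) X f \<and> bi_quotient (mtopology_of m) X f \<and>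
    at_most_boundary_one (mtopology_of m) X f \<and> countable_to_one (mtopology_of m) X f"
proof -
  obtain \<B> where \<B>: "is_base X \<B>" "\<And>x. x \<in> topspace X \<Longrightarrow> countable {B \<in> \<B>. x \<in> B}"
    using X(2) by (auto simp: has_point_countable_base_def)
  have opn: "openin X B" if "B \<in> \<B>" for B using \<B>(1) that by (simp add: is_base_def)
  have base: "\<exists>B\<in>\<B>. x \<in> B \<and> B \<subseteq> U" if "openin X U" "x \<in> U" for U x
    using \<B>(1) that by (simp add: is_base_def)
  define e where "e x = from_nat_into {B \<in> \<B>. x \<in> B}" for x
  have e: "range (e x) = {B \<in> \<B>. x \<in> B}" if "x \<in> topspace X" for x
    unfolding e_def using base[OF openin_topspace that] \<B>(2)[OF that]
    by (intro range_from_nat_into) auto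
  have inj_e: "inj_on (\<lambda>x. range (e x)) (topspace X)"
  proof (rule inj_onI, rule ccontr)
    fix x y assume *: "x \<in> topspace X" "y \<in> topspace X" "range (e x) = range (e y)" "x \<noteq> y"
    then obtain U where "openin X U" "x \<in> U" "y \<notin> U"
      using X(1) unfolding Hausdorff_space_def disjnt_def by (metis disjoint_iff)
    then obtain B where "B \<in> \<B>" "x \<in> B" "y \<notin> B" using base[of U x] by blast
    then have "B \<in> range (e x)" "B \<notin> range (e y)" using e[OF *(1)] e[OF *(2)] by simp_all
    with *(3) show False by simp
  qed
  define S where "S = j ` (topspace X \<times> UNIV)"
  define \<sigma> where "\<sigma> p = point_code e (inv j p)" for p
  define f where "f p = fst (inv j p)" for p
  have \<sigma>j: "\<sigma> (j q) = point_code e q" and fj: "f (j q) = fst q" for q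
    using j by (simp_all add: \<sigma>_def f_def)
  have inj: "inj_on \<sigma> S"
    using inj_on_point_code[OF inj_e] unfolding S_def \<sigma>_def
    by (intro comp_inj_on[of "inv j" _ "point_code e", unfolded comp_def])
      (auto simp: j inv_into_f_f image_image intro!: inj_on_inverseI[of _ j])
  interpret Metric_space S "seq_dist \<sigma>" by (rule Metric_space_seq_dist[OF inj])
  define m where "m = metric (S, seq_dist \<sigma>)"
  have m: "mtopology_of m = mtopology"
    by (simp add: m_def mtopology_of_def)
  have SD: "\<exists>x k. p = j (x, k) \<and> x \<in> topspace X" if "p \<in> S" for p
    using that by (auto simp: S_def)
  have inS: "j (x, k) \<in> S" if "x \<in> topspace X" for x k
    using that by (auto simp: S_def)
  have fS: "f ` S = topspace X"
    unfolding S_def image_image fj by simp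
  \<comment> \<open>A point of this ball has the entry \<open>Inl (e x n)\<close> at index
    \<open>n\<close>, and an \<open>Inl\<close> entry is always a base set containing the point's
    own image.\<close>
  have near: "p \<in> S \<and> f p \<in> e x n"
    if x: "x \<in> topspace X" and px: "p \<in> mball (j (x, 0)) ((1/2) ^ n)" for x p n
  proof -
    have "p \<in> S" using px by simp
    from SD[OF this] obtain y k where p: "p = j (y, k)" "y \<in> topspace X" by blast
    have "seq_dist \<sigma> (j (x, 0)) p < (1/2) ^ n" using px by simp
    from seq_dist_less_imp_eq[OF this order_refl]
    have "point_code e (y, k) n = Inl (e x n)" using p(1) by (simp add: \<sigma>j point_code_simps)
    from point_code_Inl[OF this] show ?thesis using e[OF p(2)] p inS by (auto simp: fj)
  qed
  \<comment> \<open>The radius forces agreement at index \<open>length (from_nat k)\<close>, the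
    first one that shows the tag.\<close>
  have isolated: "openin mtopology {j (x, Suc k)}" if "x \<in> topspace X" for x k
  proof -
    let ?n = "length (from_nat k :: nat list)"
    have "p = j (x, Suc k)" if px: "p \<in> mball (j (x, Suc k)) ((1/2) ^ ?n)" for p
    proof -
      have "p \<in> S" using px by simp
      from SD[OF this] obtain y i where p: "p = j (y, i)" by blast
      have "seq_dist \<sigma> (j (x, Suc k)) p < (1/2) ^ ?n" using px by simp
      from seq_dist_less_imp_eq[OF this order_refl]
      have "point_code e (y, i) ?n = Inr (x, k)" using p(1) by (simp add: \<sigma>j point_code_simps)
      from point_code_Inr[OF this] show ?thesis using p by simp
    qed
    then have "mball (j (x, Suc k)) ((1/2) ^ ?n) \<subseteq> {j (x, Suc k)}" by blast
    then show ?thesis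
      using inS[OF that] by (auto simp: openin_mtopology intro!: exI[of _ "(1/2) ^ ?n"])
  qed
  have "openin mtopology {p \<in> S. f p \<in> U}" if U: "openin X U" for U
    unfolding openin_mtopology
  proof (intro conjI allI impI)
    fix p assume "p \<in> {p \<in> S. f p \<in> U}"
    then obtain x k where p: "p = j (x, k)" "x \<in> topspace X" "x \<in> U" "p \<in> S"
      using SD by (fastforce simp: fj)
    show "\<exists>r>0. mball p r \<subseteq> {p \<in> S. f p \<in> U}"
    proof (cases k)
      case 0
      obtain B where "B \<in> \<B>" "x \<in> B" "B \<subseteq> U" using base[OF U p(3)] by blast
      then have "B \<in> range (e x)" using e[OF p(2)] by simp
      then obtain n where "e x n \<subseteq> U" using \<open>B \<subseteq> U\<close> by blast
      then have "mball p ((1/2) ^ n) \<subseteq> {p \<in> S. f p \<in> U}"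
        using near[OF p(2)] p(1) 0 by blast
      then show ?thesis by (intro exI[of _ "(1/2) ^ n"]) simp
    next
      case (Suc i)
      then obtain r where "r > 0" "mball p r \<subseteq> {p}"
        using isolated[OF p(2), of i] p(1) by (auto simp: openin_mtopology)
      then show ?thesis using p by (intro exI[of _ r]) (auto simp: fj)
    qed
  qed auto
  then have cont: "continuous_map mtopology X f"
    using fS by (auto simp: continuous_map_def)
  then have onto: "cont_onto mtopology X f"
    using fS by (simp add: cont_onto_def)
  have "countable (fibre mtopology f x)" for x
  proof (rule countable_subset)
    show "fibre mtopology f x \<subseteq> range (\<lambda>k. j (x, k))"
      using SD by (fastforce simp: fibre_def fj)
  qed simp
  then have one: "countable_to_one mtopology X f"
    by (simp add: countable_to_one_def)
  have "mtopology frontier_of (fibre mtopology f x) \<subseteq> {j (x, 0)}" if x: "x \<in> topspace X" for x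
  proof
    fix p assume p: "p \<in> mtopology frontier_of (fibre mtopology f x)"
    have "closedin mtopology {p \<in> topspace mtopology. f p \<in> {x}}"
      using x X(1) by (intro closedin_continuous_map_preimage[OF cont]) (auto simp: closedin_Hausdorff_singleton)
    then have "closedin mtopology (fibre mtopology f x)" by (simp add: fibre_def)
    then have p: "p \<in> fibre mtopology f x" "p \<notin> mtopology interior_of (fibre mtopology f x)"
      using p by (auto simp: frontier_of_def closure_of_closedin)
    then obtain k where k: "p = j (x, k)"
      using SD[of p] by (auto simp: fibre_def fj)
    show "p \<in> {j (x, 0)}"
    proof (cases k)
      case (Suc i)
      then have "p \<in> mtopology interior_of (fibre mtopology f x)"
        using isolated[OF x, of i] p(1) k by (auto simp: interior_of_def)
      with p show ?thesis by simp
    qed (simp add: k)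
  qed
  then have bdry: "at_most_boundary_one mtopology X f"
    by (auto simp: at_most_boundary_one_def)
  have "\<exists>\<U>'. finite \<U>' \<and> \<U>' \<subseteq> \<U> \<and> x \<in> X interior_of (f ` \<Union>\<U>')"
    if x: "x \<in> topspace X" and \<U>: "\<forall>U\<in>\<U>. openin mtopology U" "fibre mtopology f x \<subseteq> \<Union>\<U>" for x \<U>
  proof -
    have "j (x, 0) \<in> fibre mtopology f x"
      using inS[OF x] by (simp add: fibre_def fj)
    then obtain U where U: "U \<in> \<U>" "j (x, 0) \<in> U" using \<U>(2) by blast
    then obtain r where r: "r > 0" "mball (j (x, 0)) r \<subseteq> U"
      using \<U>(1) by (meson openin_mtopology)
    obtain n where n: "(1/2 :: real) ^ n < r"
      using real_arch_pow_inv[OF r(1), of "1/2"] by auto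
    \<comment> \<open>Points of \<open>W\<close> lie in the first \<open>n\<close> sets listed by
      \<open>e x\<close>; this lets their isolated copies imitate the first \<open>n\<close> entries
      of the code of \<open>(x, 0)\<close>.\<close>
    define W where "W = (\<Inter>i\<in>{..<n}. e x i) \<inter> topspace X"
    have mem: "e x i \<in> \<B> \<and> x \<in> e x i" for i using e[OF x] by blast
    have "W \<subseteq> f ` U"
    proof
      fix y assume y: "y \<in> W"
      then have yX: "y \<in> topspace X" and ey: "\<And>i. i < n \<Longrightarrow> y \<in> e x i"
        by (simp_all add: W_def)
      have "e x i \<in> range (e y)" if "i < n" for i
        using e[OF yX] mem ey that by simp
      then have "\<exists>k. e y k = e x i" if "i < n" for i
        using that by (metis rangeE)
      then obtain h where h: "\<And>i. i < n \<Longrightarrow> e y (h i) = e x i" by metis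
      \<comment> \<open>\<open>h\<close> locates these sets in the list of \<open>y\<close>.
        Encoding \<open>h 0, ..., h (n - 1)\<close> as the index gives an isolated copy of
        \<open>y\<close> within \<open>(1/2) ^ n\<close> of \<open>j (x, 0)\<close>.\<close>
      let ?p = "j (y, Suc (to_nat (map h [0..<n])))"
      have "seq_dist \<sigma> (j (x, 0)) ?p \<le> (1/2) ^ n"
        by (intro seq_dist_le[OF inj inS[OF x] inS[OF yX]]) (simp add: \<sigma>j point_code_simps h)
      then have "?p \<in> mball (j (x, 0)) r" using n inS x yX by simp
      then have "?p \<in> U" using r(2) by blast
      then show "y \<in> f ` U" by (intro image_eqI[of _ _ ?p]) (simp_all add: fj)
    qed
    moreover have "openin X W"
      unfolding W_def using opn mem by (intro openin_INT) simp_all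
    moreover have "x \<in> W" using x mem by (simp add: W_def)
    ultimately have "x \<in> X interior_of (f ` U)"
      unfolding interior_of_def by blast
    then show ?thesis using U(1) by (intro exI[of _ "{U}"]) simp
  qed
  then have "bi_quotient mtopology X f" unfolding bi_quotient_def by blast
  with onto one bdry show ?thesis unfolding m[symmetric] by blast
qed

theorem theorem3p9:
  fixes X :: "'a topology"
  assumes "Hausdorff_space X"
  shows
    "(has_point_countable_base X \<longleftrightarrow>
       (\<exists>(M :: ('m + 'a \<times> real) metric) f.
          cont_onto (mtopology_of M) X f \<and>
          countably_bi_quotient (mtopology_of M) X f \<and>
          s_map (mtopology_of M) X f)) \<and>
     (has_point_countable_base X \<longleftrightarrow>
       (\<exists>(M :: ('m + 'a \<times> real) metric) f.
          cont_onto (mtopology_of M) X f \<and>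
          pseudo_open (mtopology_of M) X f \<and>
          boundary_compact (mtopology_of M) X f \<and>
          s_map (mtopology_of M) X f)) \<and>
     (has_point_countable_base X \<longleftrightarrow>
       (\<exists>(M :: ('m + 'a \<times> real) metric) f.
          cont_onto (mtopology_of M) X f \<and>
          bi_quotient (mtopology_of M) X f \<and>
          at_most_boundary_one (mtopology_of M) X f \<and>
          countable_to_one (mtopology_of M) X f))"
    (is "(?one \<longleftrightarrow> ?two) \<and> (?one \<longleftrightarrow> ?three) \<and> (?one \<longleftrightarrow> ?four)")
proof -
  \<comment> \<open>The points \<open>(x, k)\<close> go into the second summand, so the construction
    works for every \<open>'m\<close>.\<close>
  have "inj (\<lambda>(x, k). Inr (x, real k) :: 'm + 'a \<times> real)"
    by (auto simp: inj_on_def)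
  then have "?one \<Longrightarrow> ?four"
    using point_countable_base_imp_bi_quotient_image[OF assms] by blast
  moreover have "?four \<Longrightarrow> ?three"
    by (meson bi_quotient_imp_pseudo_open at_most_boundary_one_imp_boundary_compact
        countable_to_one_imp_s_map)
  moreover have "?three \<Longrightarrow> ?two"
    by (meson pseudo_open_boundary_compact_imp_bi_quotient bi_quotient_imp_countably_bi_quotient
        Hausdorff_imp_t1_space assms)
  moreover have "?two \<Longrightarrow> ?one"
    by (meson countably_bi_quotient_s_image_point_countable_base mtopology_of_point_countable_base)
  ultimately show ?thesis by blast
qed

end
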